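(* For every complex $q$ with $|q|<1$, $$ \sum_{k=0}^{\infty}\frac{(q;q^2)_k^2 (q;q^2)_{2k}}{(q^2;q^2)_{2k}(q^6;q^6)_k^2}[8k+1]q^{2k^2} =\frac{(q^3;q^2)_\infty (q^3;q^6)_\infty }{(q^2;q^2)_\infty (q^6;q^6)_\infty}. $$
   Context: For $|q|<1$: $(a;q)_\infty=\prod_{j\ge0}(1-aq^j)$, $(a;q)_k=\prod_{j=0}^{k-1}(1-aq^j)$ for integers $k\ge0$, and $[n]=[n]_q=(1-q^n)/(1-q)$. *)

theory Defs
  imports "HOL-Analysis.Analysis"
begin

definition qpoch :: "complex \<Rightarrow> complex \<Rightarrow> nat \<Rightarrow> complex" where
  "qpoch a q k = (\<Prod>j<k. 1 - a * q ^ j)"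

text \<open>Meaningful for \<open>norm q < 1\<close>, where the product converges.\<close>

definition qpoch_inf :: "complex \<Rightarrow> complex \<Rightarrow> complex" where
  "qpoch_inf a q = (\<Prod>j. 1 - a * q ^ j)"

definition qbracket :: "complex \<Rightarrow> nat \<Rightarrow> complex" where
  "qbracket q n = (1 - q ^ n) / (1 - q)"

end

theory Submission
  imports Defs
begin

text \<open>
  In base \<open>p = q\<^sup>2\<close> the series is the case \<open>a = b = q\<close> of
  \<open>S(a) = \<Sum>k. (1 - a p^(4k)) (a;p)_2k (b;p)_k (p/b;p)_k p^(k\<^sup>2)
     / ((p;p)_2k (a p\<^sup>3/b;p\<^sup>3)_k (a p\<^sup>2 b;p\<^sup>3)_k)\<close>.
  A Wilf-Zeilberger certificate gives
  \<open>(1 - a p\<^sup>3/b) (1 - a p\<^sup>2 b) S(a) = (1 - a) (1 - a p\<^sup>2) S(a p\<^sup>3)\<close>;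
  iterating this relation reduces everything to \<open>S(0) = \<Sum>k. p^(k\<^sup>2) (b;p)_k (p/b;p)_k / (p;p)_2k\<close>.
  Expanding \<open>(b;p)_k (p/b;p)_k\<close> by the finite form of Jacobi's triple product and summing over
  \<open>k\<close> by a \<open>q\<close>-Vandermonde sum (Bailey's lemma) turns \<open>S(0)\<close> into \<open>1/(p;p)_\<infinity>\<close> times a theta
  series of base \<open>p\<^sup>3\<close>, which the triple product evaluates.
\<close>

section \<open>The \<open>q\<close>-Pochhammer symbol\<close>

lemma qpoch_0 [simp]: "qpoch a q 0 = 1"
  by (simp add: qpoch_def)

lemma qpoch_Suc: "qpoch a q (Suc n) = qpoch a q n * (1 - a * q ^ n)"
  by (simp add: qpoch_def)

lemma qpoch_zero_left [simp]: "qpoch 0 q n = 1"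
  by (simp add: qpoch_def)

lemma qpoch_add: "qpoch a q (m + n) = qpoch a q m * qpoch (a * q ^ m) q n"
  by (induction n) (simp_all add: qpoch_Suc power_add algebra_simps)

lemma qpoch_rec: "qpoch a q (Suc n) = (1 - a) * qpoch (a * q) q n"
  using qpoch_add[of a q 1 n] by (simp add: qpoch_Suc)

section \<open>Convergence, nonvanishing and uniform bounds of the products\<close>

lemma convergent_prod_qpoch:
  fixes a q :: complex
  assumes "norm q < 1"
  shows "convergent_prod (\<lambda>j. 1 - a * q ^ j)"
proof -
  have "summable (\<lambda>j. norm a * norm q ^ j)"
    using assms by (intro summable_mult summable_geometric) simp
  hence "abs_convergent_prod (\<lambda>j. 1 - a * q ^ j)"
    unfolding abs_convergent_prod_conv_summable by (simp add: norm_mult norm_power)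
  thus ?thesis by (rule abs_convergent_prod_imp_convergent_prod)
qed

lemma qpoch_LIMSEQ:
  assumes "norm q < 1"
  shows "(\<lambda>n. qpoch a q n) \<longlonglongrightarrow> qpoch_inf a q"
proof -
  \<comment> \<open>The limit of a convergent product is taken over \<open>j \<le> n\<close>, which
    has \<open>n + 1\<close> factors; hence the detour through \<open>Suc n\<close>.\<close>
  have "(\<lambda>n. qpoch a q (Suc n)) \<longlonglongrightarrow> qpoch_inf a q"
    using convergent_prod_LIMSEQ[OF convergent_prod_qpoch[OF assms]]
    by (simp add: qpoch_def qpoch_inf_def lessThan_Suc_atMost)
  thus ?thesis by (rule LIMSEQ_imp_Suc)
qed

lemma norm_mult_power_less_1:
  fixes a q :: "'a :: real_normed_div_algebra"
  assumes "norm q < 1" "norm a < 1"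
  shows "norm (a * q ^ j) < 1"
proof -
  have "norm a * norm q ^ j \<le> norm a * 1"
    using assms by (intro mult_left_mono power_le_one) auto
  thus ?thesis using assms by (simp add: norm_mult norm_power)
qed

lemma one_minus_mult_power_nonzero:
  fixes a q :: "'a :: real_normed_div_algebra"
  assumes "norm q < 1" "norm a < 1"
  shows "1 - a * q ^ j \<noteq> 0"
  using norm_mult_power_less_1[OF assms, of j] by auto

lemma qpoch_nonzero:
  assumes "norm q < 1" "norm a < 1"
  shows "qpoch a q n \<noteq> 0"
  unfolding qpoch_def using one_minus_mult_power_nonzero[OF assms] by simp

lemma qpoch_inf_nonzero:
  assumes "norm q < 1" "norm a < 1"
  shows "qpoch_inf a q \<noteq> 0"
  unfolding qpoch_inf_def
  by (intro prodinf_nonzero convergent_prod_qpoch one_minus_mult_power_nonzero assms)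

lemma sum_geometric_le:
  fixes r :: real
  assumes "0 \<le> r" "r < 1"
  shows "(\<Sum>j<n. r ^ j) \<le> 1 / (1 - r)"
  using assms by (simp add: sum_gp_strict divide_right_mono)

text \<open>Bounding each factor by \<open>1 + t \<le> exp t\<close> leaves a geometric series in
  the exponent. The bound depends neither on \<open>n\<close> nor on \<open>a\<close> beyond
  \<open>A\<close>, so it can serve as a dominating constant.\<close>

lemma norm_qpoch_le:
  assumes "norm q < 1" "norm a \<le> A"
  shows "norm (qpoch a q n) \<le> exp (A / (1 - norm q))"
proof -
  have A: "0 \<le> A" using assms(2) norm_ge_zero order_trans by blast
  have "norm (qpoch a q n) = (\<Prod>j<n. norm (1 - a * q ^ j))"
    by (simp add: qpoch_def prod_norm)
  also have "\<dots> \<le> (\<Prod>j<n. exp (A * norm q ^ j))"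
  proof (intro prod_mono conjI norm_ge_zero)
    fix j
    have "norm (1 - a * q ^ j) \<le> 1 + norm a * norm q ^ j"
      by (metis norm_triangle_ineq4 norm_one norm_mult norm_power)
    also have "\<dots> \<le> 1 + A * norm q ^ j"
      using assms by (intro add_left_mono mult_right_mono) auto
    also have "\<dots> \<le> exp (A * norm q ^ j)"
      by (rule exp_ge_add_one_self)
    finally show "norm (1 - a * q ^ j) \<le> exp (A * norm q ^ j)" .
  qed
  also have "\<dots> = exp (A * (\<Sum>j<n. norm q ^ j))"
    by (simp add: exp_sum sum_distrib_left)
  also have "\<dots> \<le> exp (A * (1 / (1 - norm q)))"
    using assms A sum_geometric_le[of "norm q" n] by (simp add: mult_left_mono del: times_divide_eq_right)
  finally show ?thesis by simp
qed

text \<open>The companion bound for denominators: with \<open>t = A * norm q ^ j\<close>, each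
  inverse factor is at most \<open>1 / (1 - t) = 1 + t / (1 - t)\<close>, and replacing
  \<open>1 - t\<close> by \<open>1 - A\<close> again makes the exponents geometric.\<close>

lemma norm_inverse_qpoch_le:
  assumes "norm q < 1" "norm a \<le> A" "A < 1"
  shows "norm (inverse (qpoch a q n)) \<le> exp (A / (1 - A) / (1 - norm q))"
proof -
  have A: "0 \<le> A" using assms(2) norm_ge_zero order_trans by blast
  let ?B = "A / (1 - A)"
  have "norm (inverse (qpoch a q n)) = (\<Prod>j<n. inverse (norm (1 - a * q ^ j)))"
    by (simp add: qpoch_def norm_inverse o_def prod_inversef[symmetric] flip: prod_norm)
  also have "\<dots> \<le> (\<Prod>j<n. exp (?B * norm q ^ j))"
  proof (intro prod_mono conjI)
    fix j
    define t where "t = A * norm q ^ j"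
    have t: "0 \<le> t" "t \<le> A"
      using A assms(1) mult_left_mono[of "norm q ^ j" 1 A] by (auto simp: t_def power_le_one)
    have "1 - t \<le> 1 - norm a * norm q ^ j"
      unfolding t_def using assms(2) by (simp add: mult_right_mono)
    also have "\<dots> \<le> norm (1 - a * q ^ j)"
      by (metis norm_triangle_ineq2 norm_one norm_mult norm_power)
    finally have "inverse (norm (1 - a * q ^ j)) \<le> inverse (1 - t)"
      using t assms(3) by (intro le_imp_inverse_le) auto
    also have "\<dots> = 1 + t / (1 - t)"
      using t assms(3) by (simp add: field_simps)
    also have "\<dots> \<le> 1 + t / (1 - A)"
      using t assms(3) by (intro add_left_mono divide_left_mono) auto
    also have "\<dots> \<le> exp (t / (1 - A))"
      by (rule exp_ge_add_one_self)
    finally show "inverse (norm (1 - a * q ^ j)) \<le> exp (?B * norm q ^ j)"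
      by (simp add: t_def)
  qed auto
  also have "\<dots> = exp (?B * (\<Sum>j<n. norm q ^ j))"
    by (simp add: exp_sum sum_distrib_left)
  also have "\<dots> \<le> exp (?B * (1 / (1 - norm q)))"
    using assms A sum_geometric_le[of "norm q" n]
    by (simp add: mult_left_mono del: times_divide_eq_right times_divide_eq_left)
  finally show ?thesis by simp
qed

lemma tendsto_qpoch:
  assumes "(f \<longlongrightarrow> c) F"
  shows "((\<lambda>n. qpoch (f n) q m) \<longlongrightarrow> qpoch c q m) F"
  unfolding qpoch_def using assms by (intro tendsto_intros)

lemma qpoch_inf_eq:
  assumes "norm q < 1"
  shows "qpoch_inf a q = (1 - a) * qpoch_inf (a * q) q"
proof (rule LIMSEQ_unique)
  show "(\<lambda>n. qpoch a q (Suc n)) \<longlonglongrightarrow> qpoch_inf a q"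
    using qpoch_LIMSEQ[OF assms] by (rule LIMSEQ_Suc)
  show "(\<lambda>n. qpoch a q (Suc n)) \<longlonglongrightarrow> (1 - a) * qpoch_inf (a * q) q"
    unfolding qpoch_rec by (intro tendsto_intros qpoch_LIMSEQ assms)
qed

text \<open>The factors are sorted by their exponent modulo 3. In the limit this is what reassembles
  three products of base \<open>q ^ 6\<close> into one of base \<open>q ^ 2\<close> at the
  end.\<close>

lemma qpoch_trisect:
  "qpoch a q (3 * n) = qpoch a (q ^ 3) n * qpoch (a * q) (q ^ 3) n * qpoch (a * q ^ 2) (q ^ 3) n"
proof (induction n)
  case (Suc n)
  have *: "3 * Suc n = Suc (Suc (Suc (3 * n)))" by simp
  have "(q ^ 3) ^ n = q ^ (3 * n)" by (simp add: power_mult)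
  thus ?case
    unfolding * qpoch_Suc Suc.IH
    by (simp add: power_Suc power2_eq_square algebra_simps del: power_mult)
qed simp

lemma qpoch_inf_trisect:
  assumes "norm q < 1"
  shows "qpoch_inf a q = qpoch_inf a (q ^ 3) * qpoch_inf (a * q) (q ^ 3) * qpoch_inf (a * q ^ 2) (q ^ 3)"
proof (rule LIMSEQ_unique)
  have q3: "norm (q ^ 3) < 1" using assms by (simp add: norm_power power_less_one_iff)
  show "(\<lambda>n. qpoch a q (3 * n)) \<longlonglongrightarrow> qpoch_inf a q"
    using LIMSEQ_subseq_LIMSEQ[OF qpoch_LIMSEQ[OF assms, of a], of "\<lambda>n. 3 * n"]
    by (simp add: strict_mono_def o_def)
  show "(\<lambda>n. qpoch a q (3 * n)) \<longlonglongrightarrow>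
          qpoch_inf a (q ^ 3) * qpoch_inf (a * q) (q ^ 3) * qpoch_inf (a * q ^ 2) (q ^ 3)"
    unfolding qpoch_trisect by (intro tendsto_intros qpoch_LIMSEQ q3)
qed

section \<open>Dominated convergence of series\<close>

lemma tendsto_suminf_dominated:
  fixes f :: "nat \<Rightarrow> nat \<Rightarrow> complex"
  assumes "\<And>k. (\<lambda>n. f n k) \<longlonglongrightarrow> g k"
    and "\<And>n k. norm (f n k) \<le> M k"
    and "summable M"
  shows "(\<lambda>n. suminf (f n)) \<longlonglongrightarrow> suminf g"
  using tannerys_theorem[of "\<lambda>k n. f n k" g sequentially M] assms
  by (simp add: case_prod_beta')

lemma choose_two_0 [simp]: "0 choose 2 = 0"
  by (simp add: numeral_2_eq_2)

lemma choose_two_Suc: "Suc n choose 2 = (n choose 2) + n"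
  by (simp add: numeral_2_eq_2)

text \<open>Consecutive terms have ratio \<open>r ^ j * c\<close>, which tends to 0 however large
  \<open>c\<close> is. This matters for theta series, where \<open>b\<close> or \<open>q / b\<close>
  may have norm above 1.\<close>

lemma summable_power_choose_two:
  fixes r c :: real
  assumes "0 \<le> r" "r < 1" "0 \<le> c"
  shows "summable (\<lambda>j. r ^ (j choose 2) * c ^ j)"
proof -
  have "(\<lambda>j. r ^ j * c) \<longlonglongrightarrow> 0 * c"
    using assms by (intro tendsto_intros LIMSEQ_power_zero) auto
  hence "eventually (\<lambda>j. r ^ j * c < 1/2) sequentially"
    by (intro order_tendstoD) auto
  then obtain N where N: "\<And>j. j \<ge> N \<Longrightarrow> r ^ j * c < 1/2"
    by (auto simp: eventually_at_top_linorder)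
  show ?thesis
  proof (rule summable_ratio_test)
    show "(1/2 :: real) < 1" by simp
    fix j assume "N \<le> j"
    have "(r ^ j * c) * (r ^ (j choose 2) * c ^ j) \<le> 1/2 * (r ^ (j choose 2) * c ^ j)"
      using N[OF \<open>N \<le> j\<close>] assms by (intro mult_right_mono) auto
    thus "norm (r ^ (Suc j choose 2) * c ^ Suc j) \<le> 1/2 * norm (r ^ (j choose 2) * c ^ j)"
      unfolding choose_two_Suc using assms by (simp add: power_add abs_mult ac_simps)
  qed
qed

section \<open>The \<open>q\<close>-binomial theorem\<close>

text \<open>The Gaussian binomial coefficient. The value 0 for \<open>i > n\<close> makes the Pascal
  rule valid at the boundary and lets sums be extended by a vanishing term.\<close>

definition qbinom :: "complex \<Rightarrow> nat \<Rightarrow> nat \<Rightarrow> complex" where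
  "qbinom q n i = (if i \<le> n then qpoch q q n / (qpoch q q i * qpoch q q (n - i)) else 0)"

lemma qbinom_0 [simp]: "norm q < 1 \<Longrightarrow> qbinom q n 0 = 1"
  using qpoch_nonzero[of q q n] by (simp add: qbinom_def)

lemma qbinom_eq_0 [simp]: "n < i \<Longrightarrow> qbinom q n i = 0"
  by (simp add: qbinom_def)

lemma qbinom_Suc_Suc:
  assumes q: "norm q < 1"
  shows "qbinom q (Suc n) (Suc i) = qbinom q n (Suc i) + q ^ (n - i) * qbinom q n i"
proof -
  note nz = qpoch_nonzero[OF q q]
  consider "i < n" | "i = n" | "i > n" by linarith
  thus ?thesis
  proof cases
    case 1
    then obtain d where d: "n = Suc (i + d)" using less_imp_Suc_add by blast
    define X Y Z where "X = qpoch q q i" and "Y = qpoch q q d" and "Z = qpoch q q n"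
    define s t where "s = q * q ^ i" and "t = q * q ^ d"
    have nz': "X \<noteq> 0" "Y \<noteq> 0" "1 - s \<noteq> 0" "1 - t \<noteq> 0"
      using nz one_minus_mult_power_nonzero[OF q q] by (auto simp: X_def Y_def s_def t_def)
    have "qbinom q (Suc n) (Suc i) = Z * (1 - s * t) / (X * (1 - s) * (Y * (1 - t)))"
      by (simp add: qbinom_def d Suc_diff_le qpoch_Suc X_def Y_def Z_def s_def t_def power_add mult_ac)
    moreover have "qbinom q n (Suc i) = Z / (X * (1 - s) * Y)"
      by (simp add: qbinom_def d qpoch_Suc X_def Y_def Z_def s_def)
    moreover have "q ^ (n - i) * qbinom q n i = t * (Z / (X * (Y * (1 - t))))"
      by (simp add: qbinom_def d Suc_diff_le qpoch_Suc X_def Y_def Z_def t_def)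
    \<comment> \<open>This is \<open>1 - s * t = (1 - t) + t * (1 - s)\<close> over a common
      denominator.\<close>
    moreover have "Z * (1 - s * t) / (X * (1 - s) * (Y * (1 - t))) =
        Z / (X * (1 - s) * Y) + t * (Z / (X * (Y * (1 - t))))"
      using nz' by (simp add: divide_simps) (simp add: algebra_simps)
    ultimately show ?thesis by simp
  next
    case 2
    thus ?thesis using nz[of n] nz[of "Suc n"] by (simp add: qbinom_def)
  qed simp
qed

text \<open>The Pascal rule applied under a sum with arbitrary weights \<open>f\<close>; it drives
  the inductions for both the binomial theorem and the Vandermonde sum.\<close>

lemma qbinom_sum_Suc:
  assumes "norm q < 1"
  shows "(\<Sum>i\<le>Suc n. qbinom q (Suc n) i * f i) =
         (\<Sum>i\<le>n. qbinom q n i * f i) + (\<Sum>i\<le>n. q ^ (n - i) * qbinom q n i * f (Suc i))"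
proof -
  have "(\<Sum>i\<le>n. qbinom q n i * f i) = (\<Sum>i\<le>Suc n. qbinom q n i * f i)"
    by simp
  also have "\<dots> = f 0 + (\<Sum>i\<le>n. qbinom q n (Suc i) * f (Suc i))"
    unfolding sum.atMost_Suc_shift using assms by simp
  finally show ?thesis
    unfolding sum.atMost_Suc_shift using assms
    by (simp add: qbinom_Suc_Suc distrib_right sum.distrib)
qed

theorem q_binomial:
  assumes "norm q < 1"
  shows "qpoch z q n = (\<Sum>i\<le>n. qbinom q n i * ((-z) ^ i * q ^ (i choose 2)))"
proof (induction n)
  case (Suc n)
  have "(\<Sum>i\<le>n. q ^ (n - i) * qbinom q n i * ((-z) ^ Suc i * q ^ (Suc i choose 2))) =
        - z * q ^ n * (\<Sum>i\<le>n. qbinom q n i * ((-z) ^ i * q ^ (i choose 2)))"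
    unfolding sum_distrib_left
  proof (intro sum.cong refl)
    fix i assume "i \<in> {..n}"
    hence "q ^ n = q ^ (n - i) * q ^ i" by (simp flip: power_add)
    thus "q ^ (n - i) * qbinom q n i * ((-z) ^ Suc i * q ^ (Suc i choose 2)) =
        - z * q ^ n * (qbinom q n i * ((-z) ^ i * q ^ (i choose 2)))"
      by (simp add: choose_two_Suc power_add)
  qed
  thus ?case
    unfolding qbinom_sum_Suc[OF assms] qpoch_Suc Suc.IH[symmetric] by (simp add: algebra_simps)
qed (use assms in simp)

text \<open>A limiting case of the \<open>q\<close>-Vandermonde sum. After the Pascal rule, the
  second sum is \<open>q ^ (n + j + 1)\<close> times the same sum with \<open>j + 1\<close> for
  \<open>j\<close>, which is why the induction keeps \<open>j\<close> arbitrary.\<close>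

lemma sum_qbinom_div_qpoch:
  assumes q: "norm q < 1"
  shows "(\<Sum>m\<le>n. qbinom q n m * (q ^ (m * (m + j)) / qpoch q q (m + j))) = 1 / qpoch q q (n + j)"
proof (induction n arbitrary: j)
  case (Suc n)
  have "(\<Sum>m\<le>n. q ^ (n - m) * qbinom q n m * (q ^ (Suc m * (Suc m + j)) / qpoch q q (Suc m + j))) =
        q ^ (n + j + 1) * (\<Sum>m\<le>n. qbinom q n m * (q ^ (m * (m + Suc j)) / qpoch q q (m + Suc j)))"
    unfolding sum_distrib_left
  proof (intro sum.cong refl)
    fix m assume "m \<in> {..n}"
    then obtain d where "n = m + d" using le_Suc_ex by auto
    thus "q ^ (n - m) * qbinom q n m * (q ^ (Suc m * (Suc m + j)) / qpoch q q (Suc m + j)) =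
          q ^ (n + j + 1) * (qbinom q n m * (q ^ (m * (m + Suc j)) / qpoch q q (m + Suc j)))"
      by (simp add: power_add algebra_simps)
  qed
  also have "\<dots> = q ^ (n + j + 1) / qpoch q q (n + Suc j)"
    unfolding Suc.IH by simp
  moreover have "1 / qpoch q q (n + j) + q ^ (n + j + 1) / qpoch q q (n + Suc j) = 1 / qpoch q q (Suc n + j)"
    using qpoch_nonzero[OF q q, of "n + j"] one_minus_mult_power_nonzero[OF q q, of "n + j"]
    by (simp add: qpoch_Suc field_simps)
  ultimately show ?case
    unfolding qbinom_sum_Suc[OF q] Suc.IH by simp
qed (use q in simp)

section \<open>Jacobi's triple product and Bailey's lemma\<close>

text \<open>The terms with indices \<open>j\<close> and \<open>-j\<close> of the theta series
  \<open>\<Sum>j\<in>\<int>. (-b)^j q^(j(j-1)/2)\<close>, taken together.\<close>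

definition theta_coeff :: "complex \<Rightarrow> complex \<Rightarrow> nat \<Rightarrow> complex" where
  "theta_coeff b q j = (if j = 0 then 1 else (-1) ^ j * q ^ (j choose 2) * (b ^ j + (q / b) ^ j))"


lemma choose_two_add: "(m + n) choose 2 = (m choose 2) + (n choose 2) + m * n"
  by (induction n) (simp_all add: choose_two_Suc)

lemma choose_two_double: "2 * (n choose 2) + n = n ^ 2"
  by (induction n) (simp_all add: choose_two_Suc power2_eq_square)

text \<open>Folds the range about its midpoint, matching the pairing of \<open>j\<close> and
  \<open>-j\<close> in \<open>theta_coeff\<close>.\<close>

lemma sum_atMost_double:
  fixes f :: "nat \<Rightarrow> 'a :: comm_monoid_add"
  shows "(\<Sum>i\<le>2*n. f i) = (\<Sum>j\<le>n. if j = 0 then f n else f (n + j) + f (n - j))"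
proof (induction n arbitrary: f)
  case (Suc n)
  have "(\<Sum>i\<le>2 * Suc n. f i) = f 0 + (\<Sum>i\<le>2*n. f (Suc i)) + f (2 * Suc n)"
    using sum.atMost_Suc_shift[of f "2*n"] by simp
  also have "(\<Sum>i\<le>2*n. f (Suc i)) =
      (\<Sum>j\<le>n. if j = 0 then f (Suc n) else f (Suc n + j) + f (Suc n - j))"
    unfolding Suc.IH[of "\<lambda>i. f (Suc i)"] by (intro sum.cong) (auto simp: Suc_diff_le)
  finally show ?case by (simp add: ac_simps mult_2_right)
qed simp

text \<open>Each factor is turned around by \<open>1 - b / q^m = - (b / q^m) * (1 - q^m / b)\<close>
  for \<open>m = 1, ..., n\<close>; the exponents \<open>m\<close> add up to
  \<open>Suc n choose 2\<close>.\<close>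

lemma qpoch_reflect:
  assumes "q \<noteq> 0" "b \<noteq> 0"
  shows "qpoch (b / q ^ n) q n = (- b) ^ n / q ^ (Suc n choose 2) * qpoch (q / b) q n"
proof (induction n)
  case (Suc n)
  have "qpoch (b / q ^ Suc n) q (Suc n) = (1 - b / q ^ Suc n) * qpoch (b / q ^ n) q n"
    using assms qpoch_rec[of "b / q ^ Suc n" q n] by simp
  also have "1 - b / q ^ Suc n = - b / q ^ Suc n * (1 - q / b * q ^ n)"
    using assms by (simp add: field_simps)
  finally show ?case
    unfolding Suc.IH by (simp add: qpoch_Suc[of "q / b"] choose_two_Suc[of "Suc n"] power_add mult_ac)
qed (simp add: choose_two_Suc)

theorem finite_Jacobi_triple_product:
  assumes q: "norm q < 1" "q \<noteq> 0" and b: "b \<noteq> 0"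
  shows "qpoch b q n * qpoch (q / b) q n =
         qpoch q q (2 * n) * (\<Sum>j\<le>n. theta_coeff b q j / (qpoch q q (n - j) * qpoch q q (n + j)))"
proof -
  \<comment> \<open>The binomial theorem is applied to the \<open>2 * n\<close> factors of
    \<open>qpoch z q (2 * n)\<close>: the first \<open>n\<close> reflect into
    \<open>qpoch (q / b) q n\<close> at the cost of \<open>K\<close>, the others form
    \<open>qpoch b q n\<close>. The shift by \<open>q ^ n\<close> makes the expansion symmetric
    about index \<open>n\<close>, where the terms \<open>n + j\<close> and \<open>n - j\<close>
    yield the theta coefficient of index \<open>j\<close> times \<open>K\<close>.\<close>
  define z where "z = b / q ^ n"
  define K where "K = (- b) ^ n / q ^ (Suc n choose 2)"
  have K: "K \<noteq> 0" using q b by (simp add: K_def)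
  define f where "f = (\<lambda>i. qbinom q (2 * n) i * ((-z) ^ i * q ^ (i choose 2)))"
  have up: "f (n + j) = K * (qbinom q (2 * n) (n + j) * ((-1) ^ j * q ^ (j choose 2) * b ^ j))" for j
  proof -
    have "((n + j) choose 2) + (Suc n choose 2) = n * (n + j) + (j choose 2)"
      using choose_two_double[of n] by (simp add: choose_two_add choose_two_Suc power2_eq_square algebra_simps)
    hence "q ^ ((n + j) choose 2) * q ^ (Suc n choose 2) = (q ^ n) ^ (n + j) * q ^ (j choose 2)"
      by (simp flip: power_add power_mult)
    thus ?thesis
      using q b by (simp add: f_def K_def z_def power_minus[of b] power_minus[of "b / q ^ n"] power_divide
        power_add[of b] power_add[of "-1::complex"] field_simps)
  qed
  have down: "f (n - j) = K * (qbinom q (2 * n) (n - j) * ((-1) ^ j * q ^ (j choose 2) * (q / b) ^ j))"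
    if "j \<le> n" for j
  proof -
    define d where "d = n - j"
    have d: "n = d + j" using that by (simp add: d_def)
    have "(d choose 2) + (Suc n choose 2) = n * d + (j choose 2) + j"
      using choose_two_double[of d] by (simp add: d choose_two_add choose_two_Suc power2_eq_square algebra_simps)
    hence "q ^ (d choose 2) * q ^ (Suc n choose 2) = (q ^ n) ^ d * (q ^ (j choose 2) * q ^ j)"
      by (simp only: add.assoc flip: power_add power_mult)
    hence e1: "q ^ (j choose 2) * q ^ j = q ^ (d choose 2) * q ^ (Suc n choose 2) / (q ^ n) ^ d"
      using q by (subst nonzero_eq_divide_eq) (simp_all add: mult.commute)
    have e2: "(-1) ^ n * (-1) ^ j = ((-1) ^ d :: complex)" and e3: "b ^ n / b ^ j = b ^ d"
      using b by (simp_all add: d power_add)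
    have "K * ((-1) ^ j * q ^ (j choose 2) * (q / b) ^ j) =
        ((-1) ^ n * (-1) ^ j) * (b ^ n / b ^ j) * (q ^ (j choose 2) * q ^ j) / q ^ (Suc n choose 2)"
      by (simp add: K_def power_minus[of b] power_divide mult_ac)
    also have "\<dots> = (-z) ^ d * q ^ (d choose 2)"
      unfolding e1 e2 e3 using q by (simp add: z_def power_minus[of "b / q ^ n"] power_divide mult_ac)
    finally show ?thesis by (simp add: f_def d_def mult_ac)
  qed
  have "K * (qpoch b q n * qpoch (q / b) q n) = qpoch z q (2 * n)"
    using q by (simp add: mult_2 qpoch_add z_def qpoch_reflect[OF q(2) b] K_def)
  also have "\<dots> = (\<Sum>i\<le>2*n. f i)"
    unfolding f_def by (rule q_binomial[OF q(1)])
  also have "\<dots> = (\<Sum>j\<le>n. if j = 0 then f n else f (n + j) + f (n - j))"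
    by (rule sum_atMost_double)
  also have "\<dots> = (\<Sum>j\<le>n. K * (qpoch q q (2 * n) *
                      (theta_coeff b q j / (qpoch q q (n - j) * qpoch q q (n + j)))))"
  proof (intro sum.cong refl)
    fix j assume "j \<in> {..n}"
    hence j: "j \<le> n" by simp
    have "qbinom q (2 * n) (n + j) = qpoch q q (2 * n) / (qpoch q q (n - j) * qpoch q q (n + j))"
         "qbinom q (2 * n) (n - j) = qpoch q q (2 * n) / (qpoch q q (n - j) * qpoch q q (n + j))"
      using j by (simp_all add: qbinom_def mult_2)
    thus "(if j = 0 then f n else f (n + j) + f (n - j)) =
            K * (qpoch q q (2 * n) * (theta_coeff b q j / (qpoch q q (n - j) * qpoch q q (n + j))))"
      using up[of j] down[OF j]
      by (cases "j = 0") (simp_all add: theta_coeff_def add_divide_distrib algebra_simps)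
  qed
  finally show ?thesis
    unfolding sum_distrib_left[symmetric] using K by simp
qed

text \<open>Bailey's lemma in finite form for an arbitrary sequence \<open>x\<close>. Exchange the
  sums and put \<open>n = m + j\<close>: since \<open>(m + j)^2 = j^2 + m * (m + 2 * j)\<close>, the
  inner sum is \<open>sum_qbinom_div_qpoch\<close> of length \<open>M = N - j\<close> with shift
  \<open>2 * j\<close>. The net effect is to multiply \<open>x j\<close> by
  \<open>q ^ (j^2)\<close>.\<close>

lemma Bailey_pair_sum:
  assumes q: "norm q < 1"
  shows "(\<Sum>n\<le>N. q ^ (n\<^sup>2) * (\<Sum>j\<le>n. x j / (qpoch q q (n - j) * qpoch q q (n + j))) / qpoch q q (N - n)) =
         (\<Sum>j\<le>N. x j * q ^ (j\<^sup>2) / (qpoch q q (N - j) * qpoch q q (N + j)))"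
proof -
  note nz = qpoch_nonzero[OF q q]
  define g where "g = (\<lambda>n j. q ^ (n\<^sup>2) * (x j / (qpoch q q (n - j) * qpoch q q (n + j))) / qpoch q q (N - n))"
  have "(\<Sum>n\<le>N. q ^ (n\<^sup>2) * (\<Sum>j\<le>n. x j / (qpoch q q (n - j) * qpoch q q (n + j))) / qpoch q q (N - n)) =
        (\<Sum>n\<le>N. \<Sum>j\<le>n. g n j)"
    by (simp add: g_def sum_distrib_left sum_divide_distrib)
  also have "\<dots> = (\<Sum>j\<le>N. \<Sum>n\<in>{j..N}. g n j)"
  proof -
    have "{j \<in> {..N}. j \<le> n} = {..n}" if "n \<le> N" for n using that by auto
    moreover have "{n \<in> {..N}. j \<le> n} = {j..N}" for j by auto
    ultimately show ?thesis
      using sum.swap_restrict[of "{..N}" "{..N}" g "\<lambda>n j. j \<le> n"] by simp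
  qed
  also have "\<dots> = (\<Sum>j\<le>N. x j * q ^ (j\<^sup>2) / (qpoch q q (N - j) * qpoch q q (N + j)))"
  proof (intro sum.cong refl)
    fix j assume "j \<in> {..N}"
    then obtain M where M: "N = j + M" using le_Suc_ex by auto
    have "(\<Sum>n\<in>{j..N}. g n j) = (\<Sum>m\<le>M. g (m + j) j)"
      using sum.shift_bounds_cl_nat_ivl[of "\<lambda>n. g n j" 0 j M] by (simp add: M atLeast0AtMost add.commute)
    also have "\<dots> = (\<Sum>m\<le>M. x j * q ^ (j\<^sup>2) / qpoch q q M *
                       (qbinom q M m * (q ^ (m * (m + 2 * j)) / qpoch q q (m + 2 * j))))"
    proof (intro sum.cong refl)
      fix m assume "m \<in> {..M}"
      moreover have "(m + j)\<^sup>2 = j\<^sup>2 + m * (m + 2 * j)"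
        by (simp add: power2_eq_square algebra_simps)
      moreover have "qpoch q q (j + (j + m)) = qpoch q q (m + j * 2)"
        by (simp add: mult_2_right ac_simps)
      ultimately show "g (m + j) j = x j * q ^ (j\<^sup>2) / qpoch q q M *
                       (qbinom q M m * (q ^ (m * (m + 2 * j)) / qpoch q q (m + 2 * j)))"
        using nz[of M] by (simp add: g_def M qbinom_def power_add mult_2 add.assoc field_simps)
    qed
    also have "\<dots> = x j * q ^ (j\<^sup>2) / qpoch q q M * (1 / qpoch q q (M + 2 * j))"
      by (simp only: sum_distrib_left[symmetric] sum_qbinom_div_qpoch[OF q])
    also have "\<dots> = x j * q ^ (j\<^sup>2) / (qpoch q q (N - j) * qpoch q q (N + j))"
    proof -
      have "M + 2 * j = N + j" "N - j = M" by (simp_all add: M)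
      thus ?thesis by (simp only: times_divide_times_eq mult_1_right)
    qed
    finally show "(\<Sum>n\<in>{j..N}. g n j) = x j * q ^ (j\<^sup>2) / (qpoch q q (N - j) * qpoch q q (N + j))" .
  qed
  finally show ?thesis .
qed


section \<open>Limits of the finite sums: the triple product and a theta series of base
  \<open>q ^ 3\<close>\<close>

lemma tendsto_weighted_sum:
  fixes x :: "nat \<Rightarrow> complex"
  assumes x: "summable (\<lambda>n. norm (x n))"
    and w: "\<And>n. (\<lambda>N. w N n) \<longlonglongrightarrow> L"
    and C: "\<And>N n. n \<le> N \<Longrightarrow> norm (w N n) \<le> C"
  shows "(\<lambda>N. \<Sum>n\<le>N. x n * w N n) \<longlonglongrightarrow> suminf x * L"
proof -
  \<comment> \<open>Cutting off at \<open>N\<close> turns the finite sums into series over a fixed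
    range, so dominated convergence applies with \<open>norm (x n) * C\<close>.\<close>
  define f where "f = (\<lambda>N n. if n \<le> N then x n * w N n else 0)"
  have "(\<lambda>N. suminf (f N)) \<longlonglongrightarrow> (\<Sum>n. x n * L)"
  proof (rule tendsto_suminf_dominated)
    fix n
    have "(\<lambda>N. x n * w N n) \<longlonglongrightarrow> x n * L" by (intro tendsto_intros w)
    moreover have "eventually (\<lambda>N. x n * w N n = f N n) sequentially"
      using eventually_ge_at_top[of n] by eventually_elim (simp add: f_def)
    ultimately show "(\<lambda>N. f N n) \<longlonglongrightarrow> x n * L" by (rule Lim_transform_eventually)
  next
    fix N n
    have "0 \<le> C" using C[of 0 0] norm_ge_zero order_trans by blast
    thus "norm (f N n) \<le> norm (x n) * C"
      using C by (auto simp: f_def norm_mult intro: mult_left_mono)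
  qed (use x in \<open>intro summable_mult2\<close>)
  also have "(\<Sum>n. x n * L) = suminf x * L"
    using suminf_mult2[OF summable_norm_cancel[OF x]] by simp
  also have "(\<lambda>N. suminf (f N)) = (\<lambda>N. \<Sum>n\<le>N. x n * w N n)"
  proof
    fix N
    have "suminf (f N) = sum (f N) {..N}"
      by (rule suminf_finite) (auto simp: f_def)
    thus "suminf (f N) = (\<Sum>n\<le>N. x n * w N n)" by (simp add: f_def)
  qed
  finally show ?thesis .
qed

lemma tendsto_inverse_qpoch:
  assumes "norm q < 1"
  shows "(\<lambda>N. inverse (qpoch q q (N - n))) \<longlonglongrightarrow> inverse (qpoch_inf q q)"
    and "(\<lambda>N. inverse (qpoch q q (N + n))) \<longlonglongrightarrow> inverse (qpoch_inf q q)"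
proof -
  have *: "(\<lambda>N. inverse (qpoch q q N)) \<longlonglongrightarrow> inverse (qpoch_inf q q)"
    by (intro tendsto_intros qpoch_LIMSEQ qpoch_inf_nonzero assms)
  show "(\<lambda>N. inverse (qpoch q q (N - n))) \<longlonglongrightarrow> inverse (qpoch_inf q q)"
    \<comment> \<open>Natural subtraction truncates for \<open>N < n\<close>; replacing
      \<open>N\<close> by \<open>N + n\<close> removes it.\<close>
    by (rule LIMSEQ_offset[where k = n]) (use * in simp)
  show "(\<lambda>N. inverse (qpoch q q (N + n))) \<longlonglongrightarrow> inverse (qpoch_inf q q)"
    using * by (rule LIMSEQ_ignore_initial_segment)
qed

lemma tendsto_sum_div_qpoch:
  fixes x :: "nat \<Rightarrow> complex"
  assumes q: "norm q < 1" and x: "summable (\<lambda>n. norm (x n))"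
  shows "(\<lambda>N. \<Sum>n\<le>N. x n / qpoch q q (N - n)) \<longlonglongrightarrow> suminf x / qpoch_inf q q"
  unfolding divide_inverse
  using norm_inverse_qpoch_le[OF q order.refl q]
  by (intro tendsto_weighted_sum[OF x] tendsto_inverse_qpoch(1)[OF q])

lemma tendsto_sum_div_qpoch_qpoch:
  fixes x :: "nat \<Rightarrow> complex"
  assumes q: "norm q < 1" and x: "summable (\<lambda>n. norm (x n))"
  shows "(\<lambda>N. \<Sum>n\<le>N. x n / (qpoch q q (N - n) * qpoch q q (N + n)))
           \<longlonglongrightarrow> suminf x / (qpoch_inf q q)\<^sup>2"
  unfolding divide_inverse inverse_mult_distrib power2_eq_square
proof (rule tendsto_weighted_sum[OF x])
  fix N n :: nat
  let ?C = "exp (norm q / (1 - norm q) / (1 - norm q))"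
  show "norm (inverse (qpoch q q (N - n)) * inverse (qpoch q q (N + n))) \<le> ?C * ?C"
    unfolding norm_mult using norm_inverse_qpoch_le[OF q order.refl q] by (intro mult_mono) auto
qed (intro tendsto_mult tendsto_inverse_qpoch[OF q])

lemma summable_norm_theta_coeff:
  assumes "norm q < 1"
  shows "summable (\<lambda>j. norm (theta_coeff b q j))"
proof (rule summable_comparison_test)
  let ?g = "\<lambda>j. norm q ^ (j choose 2) * norm b ^ j + norm q ^ (j choose 2) * norm (q / b) ^ j"
  show "summable ?g"
    using assms by (intro summable_add summable_power_choose_two) auto
  have "norm (theta_coeff b q j) \<le> ?g j" for j
  proof -
    have "norm (b ^ j + (q / b) ^ j) \<le> norm b ^ j + norm (q / b) ^ j"
      by (metis norm_triangle_ineq norm_power)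
    hence "norm q ^ (j choose 2) * norm (b ^ j + (q / b) ^ j) \<le> ?g j"
      unfolding distrib_left[symmetric] by (intro mult_left_mono) auto
    thus ?thesis by (simp add: theta_coeff_def norm_mult norm_power)
  qed
  thus "\<exists>N. \<forall>j\<ge>N. norm (norm (theta_coeff b q j)) \<le> ?g j" by auto
qed

text \<open>Let \<open>n\<close> tend to infinity in the finite form: the two denominators
  contribute the square of \<open>qpoch_inf q q\<close>, one power of which cancels against the
  limit of \<open>qpoch q q (2 * n)\<close>.\<close>

theorem Jacobi_triple_product:
  assumes q: "norm q < 1" "q \<noteq> 0" and b: "b \<noteq> 0"
  shows "suminf (theta_coeff b q) = qpoch_inf q q * qpoch_inf b q * qpoch_inf (q / b) q"
proof -
  have nz: "qpoch_inf q q \<noteq> 0" by (rule qpoch_inf_nonzero[OF q(1) q(1)])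
  have "(\<lambda>n. qpoch b q n * qpoch (q / b) q n) \<longlonglongrightarrow> qpoch_inf b q * qpoch_inf (q / b) q"
    by (intro tendsto_mult qpoch_LIMSEQ q)
  moreover have "(\<lambda>n. qpoch q q (2 * n)) \<longlonglongrightarrow> qpoch_inf q q"
    using LIMSEQ_subseq_LIMSEQ[OF qpoch_LIMSEQ[OF q(1), of q], of "\<lambda>n. 2 * n"]
    by (simp add: strict_mono_def o_def)
  hence "(\<lambda>n. qpoch b q n * qpoch (q / b) q n) \<longlonglongrightarrow>
           qpoch_inf q q * (suminf (theta_coeff b q) / (qpoch_inf q q)\<^sup>2)"
    unfolding finite_Jacobi_triple_product[OF q b]
    by (intro tendsto_mult tendsto_sum_div_qpoch_qpoch summable_norm_theta_coeff q)
  ultimately have "qpoch_inf b q * qpoch_inf (q / b) q =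
      qpoch_inf q q * (suminf (theta_coeff b q) / (qpoch_inf q q)\<^sup>2)"
    by (rule LIMSEQ_unique)
  thus ?thesis using nz by (simp add: field_simps power2_eq_square)
qed

text \<open>Because \<open>j^2 = 2 * (j choose 2) + j\<close>, the factor produced by Bailey's lemma
  triples the quadratic exponent and shifts \<open>b\<close> to \<open>b * q\<close>. This is where
  the base \<open>q ^ 3\<close> comes from.\<close>

lemma theta_coeff_mult_power_square:
  assumes "q \<noteq> 0" "b \<noteq> 0"
  shows "theta_coeff b q j * q ^ (j\<^sup>2) = theta_coeff (b * q) (q ^ 3) j"
proof -
  have "q ^ (j\<^sup>2) = q ^ (2 * (j choose 2)) * q ^ j"
    by (simp add: choose_two_double flip: power_add)
  moreover have "(q ^ 3) ^ (j choose 2) = q ^ (j choose 2) * q ^ (2 * (j choose 2))"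
    by (simp flip: power_mult power_add)
  moreover have "q ^ 3 / (b * q) = (q / b) * q"
    using assms by (simp add: power3_eq_cube)
  ultimately show ?thesis
    by (simp only: theta_coeff_def power_mult_distrib) (simp add: algebra_simps)
qed

lemma power_square_le:
  fixes r :: real
  assumes "0 \<le> r" "r < 1"
  shows "r ^ (n\<^sup>2) \<le> r ^ n"
  using assms by (intro power_decreasing) (auto simp: power2_eq_square)

theorem cubic_theta_sum:
  assumes q: "norm q < 1" "q \<noteq> 0" and b: "b \<noteq> 0"
  shows "(\<Sum>n. q ^ (n\<^sup>2) * (qpoch b q n * qpoch (q / b) q n / qpoch q q (2 * n))) =
         qpoch_inf (q ^ 3) (q ^ 3) * qpoch_inf (b * q) (q ^ 3) * qpoch_inf (q\<^sup>2 / b) (q ^ 3) / qpoch_inf q q"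
proof -
  have q3: "norm (q ^ 3) < 1" "q ^ 3 \<noteq> 0"
    using q by (simp_all add: norm_power power_less_one_iff)
  have nz: "qpoch_inf q q \<noteq> 0" by (rule qpoch_inf_nonzero[OF q(1) q(1)])
  define x where "x = (\<lambda>n. q ^ (n\<^sup>2) * (qpoch b q n * qpoch (q / b) q n / qpoch q q (2 * n)))"
  define C where "C = exp (norm b / (1 - norm q)) * exp (norm (q / b) / (1 - norm q)) *
                        exp (norm q / (1 - norm q) / (1 - norm q))"
  have x: "summable (\<lambda>n. norm (x n))"
  proof (rule summable_comparison_test)
    show "summable (\<lambda>n. norm q ^ n * C)"
      using q by (intro summable_mult2 summable_geometric) auto
    have "norm (x n) \<le> norm q ^ n * C" for n
    proof -
      have "norm (x n) = norm q ^ (n\<^sup>2) * (norm (qpoch b q n) * norm (qpoch (q / b) q n) *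
              norm (inverse (qpoch q q (2 * n))))"
        by (simp add: x_def norm_mult norm_power norm_divide norm_inverse divide_inverse)
      also have "\<dots> \<le> norm q ^ n * C"
        unfolding C_def using q
        by (intro mult_mono power_square_le norm_qpoch_le norm_inverse_qpoch_le) auto
      finally show ?thesis .
    qed
    thus "\<exists>N. \<forall>n\<ge>N. norm (norm (x n)) \<le> norm q ^ n * C" by auto
  qed
  have sum_eq: "(\<Sum>n\<le>N. x n / qpoch q q (N - n)) =
          (\<Sum>j\<le>N. theta_coeff (b * q) (q ^ 3) j / (qpoch q q (N - j) * qpoch q q (N + j)))" for N
  proof -
    \<comment> \<open>The finite triple product says that the quotient in \<open>x n\<close> is
      exactly the inner sum of Bailey's lemma for \<open>theta_coeff b q\<close>. Both sides of that
      lemma then converge as \<open>N\<close> grows, with one and two factors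
      \<open>qpoch_inf q q\<close> in the denominator.\<close>
    have "x n = q ^ (n\<^sup>2) * (\<Sum>j\<le>n. theta_coeff b q j / (qpoch q q (n - j) * qpoch q q (n + j)))" for n
      using finite_Jacobi_triple_product[OF q b, of n] qpoch_nonzero[OF q(1) q(1), of "2 * n"]
      by (simp add: x_def)
    thus ?thesis
      using Bailey_pair_sum[OF q(1), where x = "theta_coeff b q" and N = N]
      by (simp add: theta_coeff_mult_power_square[OF q(2) b])
  qed
  have "summable (\<lambda>j. norm (theta_coeff (b * q) (q ^ 3) j))"
    by (rule summable_norm_theta_coeff[OF q3(1)])
  hence "(\<lambda>N. \<Sum>n\<le>N. x n / qpoch q q (N - n)) \<longlonglongrightarrow>
           suminf (theta_coeff (b * q) (q ^ 3)) / (qpoch_inf q q)\<^sup>2"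
    unfolding sum_eq by (intro tendsto_sum_div_qpoch_qpoch q)
  moreover have "(\<lambda>N. \<Sum>n\<le>N. x n / qpoch q q (N - n)) \<longlonglongrightarrow> suminf x / qpoch_inf q q"
    by (intro tendsto_sum_div_qpoch q x)
  ultimately have "suminf x / qpoch_inf q q =
      suminf (theta_coeff (b * q) (q ^ 3)) / (qpoch_inf q q)\<^sup>2"
    using LIMSEQ_unique by blast
  also have "suminf (theta_coeff (b * q) (q ^ 3)) =
      qpoch_inf (q ^ 3) (q ^ 3) * qpoch_inf (b * q) (q ^ 3) * qpoch_inf (q ^ 3 / (b * q)) (q ^ 3)"
    using q b by (intro Jacobi_triple_product q3) auto
  also have "q ^ 3 / (b * q) = q\<^sup>2 / b"
    using q by (simp add: power3_eq_cube power2_eq_square)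
  finally show ?thesis
    unfolding x_def[symmetric] using nz by (simp add: field_simps power2_eq_square)
qed

section \<open>The cubic summation\<close>

text \<open>The summand without \<open>1 - a * q ^ (4 * k)\<close>; both the term and the
  certificate are polynomial multiples of it. The base is called \<open>q\<close> here and becomes
  \<open>q ^ 2\<close> in the final theorem.\<close>

definition cubic_weight :: "complex \<Rightarrow> complex \<Rightarrow> complex \<Rightarrow> nat \<Rightarrow> complex" where
  "cubic_weight a b q k =
     qpoch a q (2 * k) * qpoch b q k * qpoch (q / b) q k * q ^ (k\<^sup>2) /
     (qpoch q q (2 * k) * qpoch (a * q ^ 3 / b) (q ^ 3) k * qpoch (a * q\<^sup>2 * b) (q ^ 3) k)"

definition cubic_term :: "complex \<Rightarrow> complex \<Rightarrow> complex \<Rightarrow> nat \<Rightarrow> complex" where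
  "cubic_term a b q k = (1 - a * q ^ (4 * k)) * cubic_weight a b q k"

text \<open>The ratio of consecutive weights, cross-multiplied so that only polynomials in
  \<open>q ^ k\<close> occur.\<close>

lemma cubic_weight_Suc:
  assumes q: "norm q < 1" and ab: "norm (a * q ^ 3 / b) < 1" "norm (a * q\<^sup>2 * b) < 1"
  shows "cubic_weight a b q (Suc k) *
           ((1 - q * (q ^ k)\<^sup>2) * (1 - q\<^sup>2 * (q ^ k)\<^sup>2) *
            (1 - a * q ^ 3 / b * (q ^ k) ^ 3) * (1 - a * q\<^sup>2 * b * (q ^ k) ^ 3)) =
         cubic_weight a b q k *
           ((1 - a * (q ^ k)\<^sup>2) * (1 - a * q * (q ^ k)\<^sup>2) * (1 - b * q ^ k) * (1 - q / b * q ^ k) *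
            q * (q ^ k)\<^sup>2)"
proof -
  define x where "x = q ^ k"
  have q3: "norm (q ^ 3) < 1" using q by (simp add: norm_power power_less_one_iff)
  have x3: "(q ^ 3) ^ k = x ^ 3" by (simp add: x_def mult.commute flip: power_mult)
  have x2: "q ^ (2 * k) = x\<^sup>2" by (simp add: x_def mult.commute flip: power_mult)
  have nz: "qpoch q q (2 * k) \<noteq> 0" "qpoch (a * q ^ 3 / b) (q ^ 3) k \<noteq> 0"
      "qpoch (a * q\<^sup>2 * b) (q ^ 3) k \<noteq> 0"
    by (simp_all add: qpoch_nonzero q q3 ab)
  have nz': "1 - q * x\<^sup>2 \<noteq> 0" "1 - q\<^sup>2 * x\<^sup>2 \<noteq> 0"
      "1 - a * q ^ 3 / b * x ^ 3 \<noteq> 0" "1 - a * q\<^sup>2 * b * x ^ 3 \<noteq> 0"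
    using one_minus_mult_power_nonzero[OF q q, of "2 * k"] one_minus_mult_power_nonzero[OF q q, of "Suc (2 * k)"]
      one_minus_mult_power_nonzero[OF q3 ab(1), of k] one_minus_mult_power_nonzero[OF q3 ab(2), of k]
    by (simp_all add: x3 x2 power2_eq_square mult.assoc)
  have sq: "q ^ ((Suc k)\<^sup>2) = q ^ (k\<^sup>2) * (q * x\<^sup>2)"
    by (simp add: x_def power2_eq_square power_add mult_ac)
  have 2: "qpoch c q (2 * Suc k) = qpoch c q (2 * k) * ((1 - c * x\<^sup>2) * (1 - c * q * x\<^sup>2))" for c
    by (simp add: qpoch_Suc x2[symmetric] mult_ac)
  have 2: "qpoch a q (2 * Suc k) = qpoch a q (2 * k) * ((1 - a * x\<^sup>2) * (1 - a * q * x\<^sup>2))"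
    "qpoch q q (2 * Suc k) = qpoch q q (2 * k) * ((1 - q * x\<^sup>2) * (1 - q\<^sup>2 * x\<^sup>2))"
    by (simp_all only: 2 power2_eq_square)
  define A B where "A = 1 - a * q ^ 3 / b * x ^ 3" and "B = 1 - a * q\<^sup>2 * b * x ^ 3"
  define D E where "D = 1 - q * x\<^sup>2" and "E = 1 - q\<^sup>2 * x\<^sup>2"
  define N where "N = qpoch a q (2 * k) * qpoch b q k * qpoch (q / b) q k * q ^ (k\<^sup>2)"
  define M where "M = qpoch q q (2 * k) * qpoch (a * q ^ 3 / b) (q ^ 3) k * qpoch (a * q\<^sup>2 * b) (q ^ 3) k"
  define R where "R = (1 - a * x\<^sup>2) * (1 - a * q * x\<^sup>2) * (1 - b * x) * (1 - q / b * x) * q * x\<^sup>2"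
  have "cubic_weight a b q (Suc k) = N * R / (M * (D * E * A * B))"
    unfolding cubic_weight_def qpoch_Suc 2 sq x3 x_def[symmetric] A_def[symmetric] B_def[symmetric]
      D_def[symmetric] E_def[symmetric]
    by (simp only: N_def M_def R_def mult_ac)
  moreover have "cubic_weight a b q k = N / M"
    by (simp add: cubic_weight_def N_def M_def)
  moreover have "M \<noteq> 0" "D \<noteq> 0" "E \<noteq> 0" "A \<noteq> 0" "B \<noteq> 0"
    using nz nz' by (simp_all add: M_def D_def E_def A_def B_def)
  ultimately have "cubic_weight a b q (Suc k) * (D * E * A * B) = cubic_weight a b q k * R"
    by simp
  thus ?thesis by (simp only: A_def B_def D_def E_def R_def x_def)
qed

text \<open>The ratio under \<open>a\<close> to \<open>a * q ^ 3\<close>. This shift moves the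
  symbols of base \<open>q ^ 3\<close> by a single step and that of base \<open>q\<close> by three,
  so only finitely many factors change.\<close>

lemma cubic_weight_shift:
  assumes q: "norm q < 1" and ab: "norm (a * q ^ 3 / b) < 1" "norm (a * q\<^sup>2 * b) < 1"
  shows "(1 - a) * (1 - a * q) * (1 - a * q\<^sup>2) * cubic_weight (a * q ^ 3) b q k *
           ((1 - a * q ^ 3 / b * (q ^ k) ^ 3) * (1 - a * q\<^sup>2 * b * (q ^ k) ^ 3)) =
         (1 - a * q ^ 3 / b) * (1 - a * q\<^sup>2 * b) * cubic_weight a b q k *
           ((1 - a * (q ^ k)\<^sup>2) * (1 - a * q * (q ^ k)\<^sup>2) * (1 - a * q\<^sup>2 * (q ^ k)\<^sup>2))"
proof -
  define x where "x = q ^ k"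
  have q3: "norm (q ^ 3) < 1" using q by (simp add: norm_power power_less_one_iff)
  have x3: "(q ^ 3) ^ k = x ^ 3" by (simp add: x_def mult.commute flip: power_mult)
  have x2: "q ^ (2 * k) = x\<^sup>2" by (simp add: x_def mult.commute flip: power_mult)
  define c e where "c = a * q ^ 3 / b" and "e = a * q\<^sup>2 * b"
  define U where "U = qpoch b q k * qpoch (q / b) q k * q ^ (k\<^sup>2) / qpoch q q (2 * k)"
  have weight: "cubic_weight a b q k = U * qpoch a q (2 * k) / (qpoch c (q ^ 3) k * qpoch e (q ^ 3) k)"
    by (simp add: cubic_weight_def U_def c_def e_def mult_ac)
  have weight': "cubic_weight (a * q ^ 3) b q k =
      U * qpoch (a * q ^ 3) q (2 * k) / (qpoch (c * q ^ 3) (q ^ 3) k * qpoch (e * q ^ 3) (q ^ 3) k)"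
    by (simp add: cubic_weight_def U_def c_def e_def mult_ac)
  have num: "(1 - a) * (1 - a * q) * (1 - a * q\<^sup>2) * qpoch (a * q ^ 3) q (2 * k) =
      qpoch a q (2 * k) * ((1 - a * x\<^sup>2) * (1 - a * q * x\<^sup>2) * (1 - a * q\<^sup>2 * x\<^sup>2))"
  proof -
    have three: "qpoch u q 3 = (1 - u) * (1 - u * q) * (1 - u * q\<^sup>2)" for u
      by (simp add: numeral_3_eq_3 qpoch_Suc power2_eq_square)
    \<comment> \<open>Both sides are \<open>qpoch a q (2 * k + 3)\<close>, split in two
      ways.\<close>
    have "qpoch a q 3 * qpoch (a * q ^ 3) q (2 * k) = qpoch a q (2 * k) * qpoch (a * q ^ (2 * k)) q 3"
      by (simp only: qpoch_add[symmetric] add.commute)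
    thus ?thesis unfolding three x2 by (simp only: mult_ac)
  qed
  have den: "(1 - u) * qpoch (u * q ^ 3) (q ^ 3) k = qpoch u (q ^ 3) k * (1 - u * x ^ 3)" for u
    using qpoch_rec[of u "q ^ 3" k] qpoch_Suc[of u "q ^ 3" k] by (simp add: x3)
  have nz: "qpoch c (q ^ 3) k \<noteq> 0" "qpoch e (q ^ 3) k \<noteq> 0" "1 - c \<noteq> 0" "1 - e \<noteq> 0"
      "1 - c * x ^ 3 \<noteq> 0" "1 - e * x ^ 3 \<noteq> 0"
    using qpoch_nonzero[OF q3, of c k] qpoch_nonzero[OF q3, of e k] ab
      one_minus_mult_power_nonzero[OF q3, of c 0] one_minus_mult_power_nonzero[OF q3, of e 0]
      one_minus_mult_power_nonzero[OF q3, of c k] one_minus_mult_power_nonzero[OF q3, of e k]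
    by (simp_all add: c_def e_def x3)
  have den': "qpoch (u * q ^ 3) (q ^ 3) k = qpoch u (q ^ 3) k * (1 - u * x ^ 3) / (1 - u)"
    if "1 - u \<noteq> 0" for u
    using den[of u] that by (simp add: field_simps)
  have "(1 - a) * (1 - a * q) * (1 - a * q\<^sup>2) * cubic_weight (a * q ^ 3) b q k =
      U * (qpoch a q (2 * k) * ((1 - a * x\<^sup>2) * (1 - a * q * x\<^sup>2) * (1 - a * q\<^sup>2 * x\<^sup>2))) /
      (qpoch (c * q ^ 3) (q ^ 3) k * qpoch (e * q ^ 3) (q ^ 3) k)"
    unfolding weight' num[symmetric] by simp
  note lhs = this
  have "(1 - a) * (1 - a * q) * (1 - a * q\<^sup>2) * cubic_weight (a * q ^ 3) b q k *
           ((1 - c * x ^ 3) * (1 - e * x ^ 3)) =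
         (1 - c) * (1 - e) * cubic_weight a b q k *
           ((1 - a * x\<^sup>2) * (1 - a * q * x\<^sup>2) * (1 - a * q\<^sup>2 * x\<^sup>2))"
  proof -
    have "U * (V * S) / ((A * g / C) * (B * h / E)) * (g * h) = C * E * (U * V / (A * B)) * S"
      if "A \<noteq> 0" "B \<noteq> 0" "C \<noteq> 0" "E \<noteq> 0" "g \<noteq> 0" "h \<noteq> 0" for V S A B C E g h :: complex
      using that by simp
    from this[OF nz] show ?thesis
      unfolding lhs weight den'[OF nz(3)] den'[OF nz(4)] .
  qed
  thus ?thesis by (simp only: c_def e_def x_def)
qed

lemma cubic_certificate:
  fixes a b q x :: complex
  assumes "b \<noteq> 0"
  shows "(1 - a * x ^ 4) * (1 - a * q) * ((1 - a * q ^ 3 / b * x ^ 3) * (1 - a * q\<^sup>2 * b * x ^ 3)) -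
           (1 - a * q ^ 3 * x ^ 4) * ((1 - a * x\<^sup>2) * (1 - a * q * x\<^sup>2) * (1 - a * q\<^sup>2 * x\<^sup>2)) =
         a * (q * ((1 - a * x\<^sup>2) * (1 - a * q * x\<^sup>2) * (1 - b * x) * (1 - q / b * x) * q * x\<^sup>2) -
              (1 - x\<^sup>2) * (q - x\<^sup>2) * ((1 - a * q ^ 3 / b * x ^ 3) * (1 - a * q\<^sup>2 * b * x ^ 3)))"
proof -
  \<comment> \<open>Naming the inverse of \<open>b\<close> makes the claim polynomial, to be proved
    modulo \<open>b * c = 1\<close>.\<close>
  define c where "c = inverse b"
  have "b * c = 1" using assms by (simp add: c_def)
  thus ?thesis unfolding divide_inverse c_def[symmetric] by algebra
qed

text \<open>The factor \<open>(1 - q^(2k)) (q - q^(2k))\<close> of the certificate \<open>G\<close> cancels the two new factors of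
  \<open>(q;q)_2k\<close> in \<open>G (Suc k)\<close>, so the identity between terms becomes the polynomial identity
  \<open>cubic_certificate\<close> in \<open>x = q^k\<close>.\<close>

lemma cubic_telescope:
  assumes q: "norm q < 1" and b: "b \<noteq> 0"
    and ab: "norm (a * q ^ 3 / b) < 1" "norm (a * q\<^sup>2 * b) < 1"
  defines "G \<equiv> (\<lambda>k. (1 - (q ^ k)\<^sup>2) * (q - (q ^ k)\<^sup>2) * cubic_weight a b q k)"
  shows "(1 - a * q) * ((1 - a * q ^ 3 / b) * (1 - a * q\<^sup>2 * b) * cubic_term a b q k -
           (1 - a) * (1 - a * q\<^sup>2) * cubic_term (a * q ^ 3) b q k) =
         (1 - a * q ^ 3 / b) * (1 - a * q\<^sup>2 * b) * a * (G (Suc k) - G k)"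
proof -
  define x where "x = q ^ k"
  have q3: "norm (q ^ 3) < 1" using q by (simp add: norm_power power_less_one_iff)
  have x3: "(q ^ 3) ^ k = x ^ 3" by (simp add: x_def mult.commute flip: power_mult)
  have x4: "q ^ (4 * k) = x ^ 4" by (simp add: x_def mult.commute flip: power_mult)
  define d where "d = (1 - a * q ^ 3 / b) * (1 - a * q\<^sup>2 * b)"
  define P where "P = (1 - a * q ^ 3 / b * x ^ 3) * (1 - a * q\<^sup>2 * b * x ^ 3)"
  define h h1 h' where "h = cubic_weight a b q k" and "h1 = cubic_weight a b q (Suc k)"
    and "h' = cubic_weight (a * q ^ 3) b q k"
  define S where "S = (1 - a * x\<^sup>2) * (1 - a * q * x\<^sup>2) * (1 - a * q\<^sup>2 * x\<^sup>2)"
  define R where "R = (1 - a * x\<^sup>2) * (1 - a * q * x\<^sup>2) * (1 - b * x) * (1 - q / b * x) * q * x\<^sup>2"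
  have P: "P \<noteq> 0"
    using one_minus_mult_power_nonzero[OF q3 ab(1), of k] one_minus_mult_power_nonzero[OF q3 ab(2), of k]
    by (simp add: P_def x3)
  have shift: "(1 - a) * (1 - a * q) * (1 - a * q\<^sup>2) * h' * P = d * h * S"
    using cubic_weight_shift[OF q ab, of k] unfolding h'_def h_def P_def d_def S_def x_def .
  have step: "h1 * ((1 - q * x\<^sup>2) * (1 - q\<^sup>2 * x\<^sup>2) * P) = h * R"
    using cubic_weight_Suc[OF q ab, of k] unfolding h1_def h_def P_def R_def x_def by (simp only: mult.assoc)
  have cert: "(1 - a * x ^ 4) * (1 - a * q) * P - (1 - a * q ^ 3 * x ^ 4) * S =
      a * (q * R - (1 - x\<^sup>2) * (q - x\<^sup>2) * P)"
    using cubic_certificate[OF b, of a x q] unfolding P_def S_def R_def .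
  have terms: "cubic_term a b q k = (1 - a * x ^ 4) * h"
      "cubic_term (a * q ^ 3) b q k = (1 - a * q ^ 3 * x ^ 4) * h'"
    by (simp_all add: cubic_term_def h_def h'_def x4)
  have G: "G (Suc k) = q * ((1 - q\<^sup>2 * x\<^sup>2) * (1 - q * x\<^sup>2) * h1)" "G k = (1 - x\<^sup>2) * (q - x\<^sup>2) * h"
    by (simp_all add: G_def h1_def h_def x_def power2_eq_square algebra_simps)
  \<comment> \<open>The factor \<open>P\<close> is multiplied in so that \<open>shift\<close> and
    \<open>step\<close> apply, and cancelled at the end. The factor \<open>1 - a * q\<close> is
    carried along because \<open>shift\<close> needs it next to \<open>1 - a\<close> and
    \<open>1 - a * q\<^sup>2\<close>.\<close>
  have "(1 - a * q) * (d * cubic_term a b q k - (1 - a) * (1 - a * q\<^sup>2) * cubic_term (a * q ^ 3) b q k) * P =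
        d * h * (1 - a * x ^ 4) * (1 - a * q) * P -
        (1 - a * q ^ 3 * x ^ 4) * ((1 - a) * (1 - a * q) * (1 - a * q\<^sup>2) * h' * P)"
    unfolding terms by (simp add: algebra_simps)
  also have "\<dots> = d * h * ((1 - a * x ^ 4) * (1 - a * q) * P - (1 - a * q ^ 3 * x ^ 4) * S)"
    unfolding shift by (simp add: algebra_simps)
  also have "\<dots> = d * a * (q * (h * R) - (1 - x\<^sup>2) * (q - x\<^sup>2) * h * P)"
    unfolding cert by (simp add: algebra_simps)
  also have "\<dots> = d * a * (G (Suc k) - G k) * P"
    unfolding step[symmetric] G by (simp add: algebra_simps)
  finally show ?thesis using P by (simp add: d_def)
qed


section \<open>Summability, the functional equation and the limit \<open>a\<close> to 0\<close>

text \<open>One constant \<open>C\<close> serves all \<open>a\<close> with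
  \<open>norm a \<le> A\<close>, so the same majorant covers every \<open>a * (q ^ 3) ^ n\<close>
  when the relation in \<open>a\<close> is iterated.\<close>

lemma norm_cubic_weight_le:
  assumes q: "norm q < 1"
    and A: "A * norm (q ^ 3 / b) < 1" "A * norm (q\<^sup>2 * b) < 1"
  obtains C where "\<And>a k. norm a \<le> A \<Longrightarrow> norm (cubic_weight a b q k) \<le> norm q ^ k * C"
proof -
  define r s where "r = A * norm (q ^ 3 / b)" and "s = A * norm (q\<^sup>2 * b)"
  have q3: "norm (q ^ 3) < 1" using q by (simp add: norm_power power_less_one_iff)
  let ?e = "1 - norm q" and ?e3 = "1 - norm (q ^ 3)"
  define C where "C = exp (A / ?e) * exp (norm b / ?e) * exp (norm (q / b) / ?e) *
    (exp (norm q / ?e / ?e) * exp (r / (1 - r) / ?e3) * exp (s / (1 - s) / ?e3))"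
  have "norm (cubic_weight a b q k) \<le> norm q ^ k * C" if a: "norm a \<le> A" for a k
  proof -
    have r: "norm (a * q ^ 3 / b) \<le> r"
      using mult_right_mono[OF a, of "norm (q ^ 3 / b)"] by (simp add: r_def norm_mult norm_divide)
    have s: "norm (a * q\<^sup>2 * b) \<le> s"
      using mult_right_mono[OF a, of "norm (q\<^sup>2 * b)"] by (simp add: s_def norm_mult mult.assoc)
    have "norm (cubic_weight a b q k) = norm q ^ (k\<^sup>2) *
        (norm (qpoch a q (2 * k)) * norm (qpoch b q k) * norm (qpoch (q / b) q k) *
         (norm (inverse (qpoch q q (2 * k))) * norm (inverse (qpoch (a * q ^ 3 / b) (q ^ 3) k)) *
          norm (inverse (qpoch (a * q\<^sup>2 * b) (q ^ 3) k))))"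
      by (simp add: cubic_weight_def norm_mult norm_divide norm_power norm_inverse divide_inverse)
    also have "\<dots> \<le> norm q ^ k * C"
      unfolding C_def using q q3 a r s A
      by (intro mult_mono power_square_le norm_qpoch_le norm_inverse_qpoch_le mult_nonneg_nonneg)
         (auto simp: r_def s_def)
    finally show ?thesis .
  qed
  thus ?thesis using that by blast
qed

lemma norm_cubic_term_le:
  assumes q: "norm q < 1"
    and A: "0 \<le> A" "A * norm (q ^ 3 / b) < 1" "A * norm (q\<^sup>2 * b) < 1"
  obtains C where "\<And>a k. norm a \<le> A \<Longrightarrow> norm (cubic_term a b q k) \<le> norm q ^ k * C"
proof -
  obtain C where C: "\<And>a k. norm a \<le> A \<Longrightarrow> norm (cubic_weight a b q k) \<le> norm q ^ k * C"
    using norm_cubic_weight_le[OF q A(2,3)] by blast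
  have "norm (cubic_term a b q k) \<le> norm q ^ k * ((1 + A) * C)" if a: "norm a \<le> A" for a k
  proof -
    have "norm (a * q ^ (4 * k)) \<le> A * 1"
      unfolding norm_mult norm_power using a q A(1) by (intro mult_mono power_le_one) auto
    hence "norm (1 - a * q ^ (4 * k)) \<le> 1 + A"
      using norm_triangle_ineq4[of 1 "a * q ^ (4 * k)"] by simp
    hence "norm (cubic_term a b q k) \<le> (1 + A) * (norm q ^ k * C)"
      unfolding cubic_term_def norm_mult using C[OF a] A(1) by (intro mult_mono) auto
    thus ?thesis by (simp add: mult_ac)
  qed
  thus ?thesis using that by blast
qed

lemma summable_cubic_term:
  assumes q: "norm q < 1" and ab: "norm (a * q ^ 3 / b) < 1" "norm (a * q\<^sup>2 * b) < 1"
  shows "summable (cubic_term a b q)"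
proof -
  obtain C where "\<And>k. norm (cubic_term a b q k) \<le> norm q ^ k * C"
    using norm_cubic_term_le[OF q, of "norm a" b] ab
    by (metis norm_ge_zero norm_mult mult.assoc times_divide_eq_right order.refl)
  moreover have "summable (\<lambda>k. norm q ^ k * C)"
    using q by (intro summable_mult2 summable_geometric) auto
  ultimately show ?thesis by (intro summable_comparison_test[of "cubic_term a b q"]) auto
qed

lemma cubic_sum_shift:
  assumes q: "norm q < 1" and b: "b \<noteq> 0"
    and ab: "norm (a * q) < 1" "norm (a * q ^ 3 / b) < 1" "norm (a * q\<^sup>2 * b) < 1"
  shows "(1 - a * q ^ 3 / b) * (1 - a * q\<^sup>2 * b) * suminf (cubic_term a b q) =
         (1 - a) * (1 - a * q\<^sup>2) * suminf (cubic_term (a * q ^ 3) b q)"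
proof -
  define G where "G = (\<lambda>k. (1 - (q ^ k)\<^sup>2) * (q - (q ^ k)\<^sup>2) * cubic_weight a b q k)"
  define d where "d = (1 - a * q ^ 3 / b) * (1 - a * q\<^sup>2 * b)"
  have q3: "norm (q ^ 3) < 1" using q by (simp add: norm_power power_less_one_iff)
  have ab': "norm (a * q ^ 3 * q ^ 3 / b) < 1" "norm (a * q ^ 3 * q\<^sup>2 * b) < 1"
    using norm_mult_power_less_1[OF q3 ab(2), of 1] norm_mult_power_less_1[OF q3 ab(3), of 1]
    by (simp_all add: mult_ac)
  have sums: "cubic_term a b q sums suminf (cubic_term a b q)"
    "cubic_term (a * q ^ 3) b q sums suminf (cubic_term (a * q ^ 3) b q)"
    by (intro summable_sums summable_cubic_term q ab ab')+
  have q_lim: "(\<lambda>k. q ^ k) \<longlonglongrightarrow> 0" using q by (rule LIMSEQ_power_zero)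
  have "cubic_weight a b q \<longlonglongrightarrow> 0"
  proof -
    obtain C where C: "\<And>k. norm (cubic_weight a b q k) \<le> norm q ^ k * C"
      using norm_cubic_weight_le[OF q, of "norm a" b] ab
      by (metis norm_mult mult.assoc times_divide_eq_right order.refl)
    have "(\<lambda>k. norm q ^ k * C) \<longlonglongrightarrow> 0 * C"
      using q by (intro tendsto_intros LIMSEQ_power_zero) auto
    thus ?thesis using C by (intro Lim_null_comparison[of "cubic_weight a b q"]) auto
  qed
  hence "G \<longlonglongrightarrow> (1 - 0\<^sup>2) * (q - 0\<^sup>2) * 0"
    unfolding G_def by (intro tendsto_intros q_lim)
  \<comment> \<open>Both ends of the telescoping sum vanish: \<open>G 0 = 0\<close> by its factor
    \<open>1 - (q ^ 0)\<^sup>2\<close>, and \<open>G\<close> tends to 0 with the weight.\<close>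
  hence "(\<lambda>k. G (Suc k) - G k) sums 0"
    using telescope_sums[of G 0] by (simp add: G_def)
  hence "(\<lambda>k. d * a * (G (Suc k) - G k)) sums (d * a * 0)"
    by (rule sums_mult)
  moreover have "(\<lambda>k. (1 - a * q) * (d * cubic_term a b q k - (1 - a) * (1 - a * q\<^sup>2) * cubic_term (a * q ^ 3) b q k))
      sums ((1 - a * q) * (d * suminf (cubic_term a b q) - (1 - a) * (1 - a * q\<^sup>2) * suminf (cubic_term (a * q ^ 3) b q)))"
    by (intro sums_mult sums_diff sums)
  ultimately have "(1 - a * q) * (d * suminf (cubic_term a b q) -
      (1 - a) * (1 - a * q\<^sup>2) * suminf (cubic_term (a * q ^ 3) b q)) = d * a * 0"
    unfolding d_def G_def cubic_telescope[OF q b ab(2,3)] using sums_unique2 by blast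
  \<comment> \<open>This allows the auxiliary factor \<open>1 - a * q\<close> of the telescoping
    identity to be cancelled.\<close>
  moreover have "a * q \<noteq> 1" using ab(1) by auto
  ultimately show ?thesis by (simp add: d_def)
qed

theorem cubic_summation:
  assumes q: "norm q < 1" "q \<noteq> 0" and b: "b \<noteq> 0"
    and ab: "norm (a * q) < 1" "norm (a * q ^ 3 / b) < 1" "norm (a * q\<^sup>2 * b) < 1"
  shows "cubic_term a b q sums
    (qpoch_inf a (q ^ 3) * qpoch_inf (a * q\<^sup>2) (q ^ 3) /
       (qpoch_inf (a * q ^ 3 / b) (q ^ 3) * qpoch_inf (a * q\<^sup>2 * b) (q ^ 3)) *
     (qpoch_inf (q ^ 3) (q ^ 3) * qpoch_inf (b * q) (q ^ 3) * qpoch_inf (q\<^sup>2 / b) (q ^ 3) / qpoch_inf q q))"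
proof -
  have q3: "norm (q ^ 3) < 1" using q by (simp add: norm_power power_less_one_iff)
  let ?S = "\<lambda>a. suminf (cubic_term a b q)"
  let ?c = "a * q ^ 3 / b" and ?e = "a * q\<^sup>2 * b"
  let ?a = "\<lambda>n. a * (q ^ 3) ^ n"
  have norm_a: "norm (?a n) \<le> norm a" for n
  proof -
    have "norm a * norm (q ^ 3) ^ n \<le> norm a * 1"
      using q3 by (intro mult_left_mono power_le_one) auto
    thus ?thesis by (simp only: norm_mult norm_power mult_1_right)
  qed
  have step: "qpoch ?c (q ^ 3) n * qpoch ?e (q ^ 3) n * ?S a =
      qpoch a (q ^ 3) n * qpoch (a * q\<^sup>2) (q ^ 3) n * ?S (?a n)" for n
  proof (induction n)
    case (Suc n)
    define y where "y = (q ^ 3) ^ n"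
    \<comment> \<open>Powers of \<open>q ^ 3\<close> do not increase norms, so the hypotheses of
      \<open>cubic_sum_shift\<close> persist along the iteration.\<close>
    have ab': "norm (a * y * q) < 1" "norm (a * y * q ^ 3 / b) < 1" "norm (a * y * q\<^sup>2 * b) < 1"
      using norm_mult_power_less_1[OF q3 ab(1), of n] norm_mult_power_less_1[OF q3 ab(2), of n]
        norm_mult_power_less_1[OF q3 ab(3), of n]
      by (simp_all add: y_def[symmetric] mult_ac)
    have "qpoch ?c (q ^ 3) (Suc n) * qpoch ?e (q ^ 3) (Suc n) * ?S a =
        qpoch ?c (q ^ 3) n * qpoch ?e (q ^ 3) n * ?S a * ((1 - ?c * y) * (1 - ?e * y))"
      by (simp only: qpoch_Suc y_def[symmetric] mult_ac)
    also have "\<dots> = qpoch a (q ^ 3) n * qpoch (a * q\<^sup>2) (q ^ 3) n *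
        ((1 - a * y * q ^ 3 / b) * (1 - a * y * q\<^sup>2 * b) * ?S (a * y))"
      unfolding Suc.IH y_def[symmetric] by (simp add: mult_ac)
    also have "\<dots> = qpoch a (q ^ 3) n * qpoch (a * q\<^sup>2) (q ^ 3) n *
        ((1 - a * y) * (1 - a * y * q\<^sup>2) * ?S (a * y * q ^ 3))"
      unfolding cubic_sum_shift[OF q(1) b ab'] ..
    also have "\<dots> = qpoch a (q ^ 3) (Suc n) * qpoch (a * q\<^sup>2) (q ^ 3) (Suc n) * ?S (?a (Suc n))"
      by (simp only: qpoch_Suc power_Suc y_def[symmetric] mult_ac)
    finally show ?case .
  qed simp
  have a_lim: "?a \<longlonglongrightarrow> 0"
    using tendsto_mult[OF tendsto_const[of a] LIMSEQ_power_zero[OF q3]] by simp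
  have "(\<lambda>n. ?S (?a n)) \<longlonglongrightarrow> ?S 0"
  proof -
    obtain C where C: "\<And>a' k. norm a' \<le> norm a \<Longrightarrow> norm (cubic_term a' b q k) \<le> norm q ^ k * C"
      using norm_cubic_term_le[OF q(1), of "norm a" b] ab
      by (metis norm_ge_zero norm_mult mult.assoc times_divide_eq_right)
    show ?thesis
    proof (rule tendsto_suminf_dominated)
      show "norm (cubic_term (?a n) b q k) \<le> norm q ^ k * C" for n k
        by (intro C norm_a)
      show "summable (\<lambda>k. norm q ^ k * C)"
        using q by (intro summable_mult2 summable_geometric) auto
      fix k
      \<comment> \<open>The arguments of the two symbols of base \<open>q ^ 3\<close> tend to 0, so
        these symbols tend to 1 and the limiting denominator is \<open>qpoch q q (2 * k)\<close>,
        which is nonzero.\<close>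
      have lim_c: "(\<lambda>n. ?a n * q ^ 3 / b) \<longlonglongrightarrow> 0" and lim_e: "(\<lambda>n. ?a n * q\<^sup>2 * b) \<longlonglongrightarrow> 0"
        using tendsto_mult_left_zero[OF a_lim, of "q ^ 3 / b"] tendsto_mult_left_zero[OF a_lim, of "q\<^sup>2 * b"]
        by (simp_all add: mult.assoc)
      show "(\<lambda>n. cubic_term (?a n) b q k) \<longlonglongrightarrow> cubic_term 0 b q k"
        unfolding cubic_term_def cubic_weight_def
        by (intro tendsto_intros tendsto_qpoch a_lim)
           (use lim_c lim_e b qpoch_nonzero[OF q(1) q(1)] in auto)
    qed
  qed
  hence "(\<lambda>n. qpoch a (q ^ 3) n * qpoch (a * q\<^sup>2) (q ^ 3) n * ?S (?a n)) \<longlonglongrightarrow>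
      qpoch_inf a (q ^ 3) * qpoch_inf (a * q\<^sup>2) (q ^ 3) * ?S 0"
    by (intro tendsto_mult qpoch_LIMSEQ q3)
  moreover have "(\<lambda>n. qpoch ?c (q ^ 3) n * qpoch ?e (q ^ 3) n * ?S a) \<longlonglongrightarrow>
      qpoch_inf ?c (q ^ 3) * qpoch_inf ?e (q ^ 3) * ?S a"
    by (intro tendsto_mult qpoch_LIMSEQ q3 tendsto_const)
  ultimately have eq: "qpoch_inf ?c (q ^ 3) * qpoch_inf ?e (q ^ 3) * ?S a =
      qpoch_inf a (q ^ 3) * qpoch_inf (a * q\<^sup>2) (q ^ 3) * ?S 0"
    unfolding step by (intro LIMSEQ_unique)
  \<comment> \<open>At \<open>a = 0\<close> every factor involving \<open>a\<close> becomes 1, which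
    leaves the series of \<open>cubic_theta_sum\<close>.\<close>
  have "cubic_term 0 b q = (\<lambda>n. q ^ (n\<^sup>2) * (qpoch b q n * qpoch (q / b) q n / qpoch q q (2 * n)))"
    by (simp add: fun_eq_iff cubic_term_def cubic_weight_def)
  hence "?S 0 = qpoch_inf (q ^ 3) (q ^ 3) * qpoch_inf (b * q) (q ^ 3) * qpoch_inf (q\<^sup>2 / b) (q ^ 3) / qpoch_inf q q"
    using cubic_theta_sum[OF q b] by simp
  moreover have "qpoch_inf ?c (q ^ 3) * qpoch_inf ?e (q ^ 3) \<noteq> 0"
    using qpoch_inf_nonzero[OF q3] ab by simp
  hence "?S a = qpoch_inf a (q ^ 3) * qpoch_inf (a * q\<^sup>2) (q ^ 3) /
       (qpoch_inf ?c (q ^ 3) * qpoch_inf ?e (q ^ 3)) * ?S 0"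
    using eq by (simp add: nonzero_eq_divide_eq mult.commute)
  ultimately show ?thesis
    using summable_sums[OF summable_cubic_term[OF q(1) ab(2,3)]] by simp
qed

section \<open>Specialisation to base \<open>p = q ^ 2\<close> with \<open>a = b = q\<close>\<close>

theorem theorem3:
  fixes q :: complex
  assumes "norm q < 1"
  shows "(\<lambda>k. (qpoch q (q^2) k)^2 * qpoch q (q^2) (2*k)
              / (qpoch (q^2) (q^2) (2*k) * (qpoch (q^6) (q^6) k)^2)
              * qbracket q (8*k+1) * q ^ (2 * k^2))
         sums
         (qpoch_inf (q^3) (q^2) * qpoch_inf (q^3) (q^6)
          / (qpoch_inf (q^2) (q^2) * qpoch_inf (q^6) (q^6)))"
proof (cases "q = 0")
  case True
  have "(\<lambda>k. (qpoch q (q^2) k)^2 * qpoch q (q^2) (2*k)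
              / (qpoch (q^2) (q^2) (2*k) * (qpoch (q^6) (q^6) k)^2)
              * qbracket q (8*k+1) * q ^ (2 * k^2)) = (\<lambda>k. if k = 0 then 1 else 0)"
    using True by (auto simp: fun_eq_iff qbracket_def power_0_left)
  moreover have "qpoch_inf 0 p = 1" for p
    by (simp add: qpoch_inf_def)
  ultimately show ?thesis
    using True sums_single[of 0 "\<lambda>_. 1 :: complex"] by simp
next
  case False
  define p where "p = q\<^sup>2"
  have small: "norm (q ^ n) < 1" if "0 < n" for n
    using assms that by (simp add: norm_power power_less_one_iff)
  have p: "norm p < 1" "p \<noteq> 0" using small[of 2] False by (simp_all add: p_def)
  have q1: "1 - q \<noteq> 0" using assms by auto
  \<comment> \<open>With \<open>a = b = q\<close> both cubic denominators have argument
    \<open>q ^ 6\<close>, and \<open>p / b = q\<close>; this produces the two squares in the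
    summand.\<close>
  have powers: "p ^ 3 = q ^ 6" "q * p = q ^ 3" "q * q ^ 6 / q = q ^ 6" "q * p\<^sup>2 = q ^ 5"
      "q ^ 5 * q = q ^ 6" "p\<^sup>2 / q = q ^ 3" "p / q = q"
    using False by (simp_all add: p_def power_numeral_reduce)
  have nz: "qpoch_inf (q ^ 6) (q ^ 6) \<noteq> 0" "qpoch_inf p p \<noteq> 0"
    by (simp_all add: qpoch_inf_nonzero small p)
  have "cubic_term q q p sums
    (qpoch_inf q (q ^ 6) * qpoch_inf (q ^ 5) (q ^ 6) /
       (qpoch_inf (q ^ 6) (q ^ 6) * qpoch_inf (q ^ 6) (q ^ 6)) *
     (qpoch_inf (q ^ 6) (q ^ 6) * qpoch_inf (q ^ 3) (q ^ 6) * qpoch_inf (q ^ 3) (q ^ 6) / qpoch_inf p p))"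
  proof -
    have "norm (q * p) < 1" "norm (q * p ^ 3 / q) < 1" "norm (q * p\<^sup>2 * q) < 1"
      unfolding powers by (simp_all add: small)
    from cubic_summation[OF p False this] show ?thesis unfolding powers .
  qed
  also have "qpoch_inf q (q ^ 6) * qpoch_inf (q ^ 5) (q ^ 6) /
       (qpoch_inf (q ^ 6) (q ^ 6) * qpoch_inf (q ^ 6) (q ^ 6)) *
     (qpoch_inf (q ^ 6) (q ^ 6) * qpoch_inf (q ^ 3) (q ^ 6) * qpoch_inf (q ^ 3) (q ^ 6) / qpoch_inf p p) =
     (1 - q) * (qpoch_inf (q ^ 3) p * qpoch_inf (q ^ 3) (q ^ 6) / (qpoch_inf p p * qpoch_inf (q ^ 6) (q ^ 6)))"
  proof -
    \<comment> \<open>Trisecting \<open>qpoch_inf q p\<close> gives the starting exponents 1, 3, 5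
      in base \<open>q ^ 6\<close>; splitting off its first factor leaves
      \<open>qpoch_inf (q ^ 3) p\<close>. One of the two copies of
      \<open>qpoch_inf (q ^ 3) (q ^ 6)\<close> is used up here, the other remains in the
      result.\<close>
    have trisect: "qpoch_inf q (q ^ 6) * qpoch_inf (q ^ 3) (q ^ 6) * qpoch_inf (q ^ 5) (q ^ 6) =
        (1 - q) * qpoch_inf (q ^ 3) p"
      using trans[OF qpoch_inf_trisect[OF p(1), of q, symmetric] qpoch_inf_eq[OF p(1), of q]]
      unfolding powers .
    have regroup: "x * z / (Q * Q) * (Q * t * t / P) = (x * t * z) * t / (P * Q)"
      if "Q \<noteq> 0" for x z Q t P :: complex
      using that by (simp add: mult_ac)
    show ?thesis
      unfolding regroup[OF nz(1)] trisect by (simp only: times_divide_eq_right mult.assoc)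
  qed
  \<comment> \<open>Dividing by \<open>1 - q\<close> turns \<open>1 - q * p ^ (4 * k)\<close> into
    the bracket and removes the factor split off on the right.\<close>
  finally have "(\<lambda>k. cubic_term q q p k / (1 - q)) sums
     ((1 - q) * (qpoch_inf (q ^ 3) p * qpoch_inf (q ^ 3) (q ^ 6) / (qpoch_inf p p * qpoch_inf (q ^ 6) (q ^ 6))) / (1 - q))"
    by (rule sums_divide)
  moreover have "cubic_term q q p k / (1 - q) = (qpoch q p k)^2 * qpoch q p (2*k)
              / (qpoch p p (2*k) * (qpoch (q^6) (q^6) k)^2) * qbracket q (8*k+1) * q ^ (2 * k^2)" for k
  proof -
    have exponents: "p ^ (4 * k) = q ^ (8 * k)" "p ^ (k\<^sup>2) = q ^ (2 * k\<^sup>2)"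
        "q ^ (8 * k + 1) = q * q ^ (8 * k)"
      unfolding p_def power_mult[symmetric] by simp_all
    have regroup: "u * (A * B * B * w / (C * D * D)) / v = B\<^sup>2 * A / (C * D\<^sup>2) * (u / v) * w"
      for u v w A B C D :: complex
      by (simp add: power2_eq_square mult_ac)
    show ?thesis
      unfolding cubic_term_def cubic_weight_def powers qbracket_def exponents by (rule regroup)
  qed
  ultimately show ?thesis
    unfolding p_def by (simp only: nonzero_mult_div_cancel_left[OF q1])
qed

end
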